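(* For every integer $n\geq 2$ there exists a finite topological $T_0$-space $X$ such that $|D(X)|=1$ and $S_F(X)=n$.
   Context: For a finite topological $T_0$-space $X$ and $x\in X$, $U_x$ is the intersection of all open sets containing $x$. The relation $x\leq y \iff U_x\subseteq U_y$ is a partial order on $X$, so $U_x=\{y: y\le x\}$; open sets are exactly the lower sets, and finite $T_0$-spaces correspond bijectively in this way to finite partially ordered sets. A point $x\in X$ is a down beat point if $U_x\setminus\{x\}$ has a maximum. $D(X)$ denotes the set of down beat points of $X$. $\mathbb{R}_0^+$ is the set of non-negative real numbers with the usual topology. A semiflow on $X$ is a continuous map $\varphi:\mathbb{R}_0^+\times X\to X$ (product topology on the domain) such that $\varphi(0,x)=x$ for all $x\in X$ and $\varphi(s,\varphi(t,x))=\varphi(s+t,x)$ for all $x\in X$, $s,t\in\mathbb{R}_0^+$. $S_F(X)$ denotes the number of distinct semiflows on $X$ (including the trivial one, $\varphi(t,x)=x$). *)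

theory Defs
  imports "HOL-Analysis.Analysis"
begin

definition min_open :: "'a topology \<Rightarrow> 'a \<Rightarrow> 'a set" where
  "min_open X x = \<Inter>{U. openin X U \<and> x \<in> U}"

definition spec_le :: "'a topology \<Rightarrow> 'a \<Rightarrow> 'a \<Rightarrow> bool" where
  "spec_le X x y \<longleftrightarrow> min_open X x \<subseteq> min_open X y"

definition down_beat_points :: "'a topology \<Rightarrow> 'a set" where
  "down_beat_points X =
     {x \<in> topspace X. \<exists>m \<in> min_open X x - {x}. \<forall>y \<in> min_open X x - {x}. spec_le X y m}"

definition semiflow :: "'a topology \<Rightarrow> (real \<times> 'a \<Rightarrow> 'a) \<Rightarrow> bool" where
  "semiflow X \<phi> \<longleftrightarrow>
     continuous_map (prod_topology (top_of_set {0..}) X) X \<phi> \<and>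
     (\<forall>x \<in> topspace X. \<phi> (0, x) = x) \<and>
     (\<forall>x \<in> topspace X. \<forall>s \<ge> 0. \<forall>t \<ge> 0. \<phi> (s, \<phi> (t, x)) = \<phi> (s + t, x))"

(* A map defined on [0,\<infinity>) \<times> X is represented by its unique extensional
   representative, so that maps differing only off that domain are counted once. *)
definition semiflows :: "'a topology \<Rightarrow> (real \<times> 'a \<Rightarrow> 'a) set" where
  "semiflows X = {\<phi> \<in> extensional ({0..} \<times> topspace X). semiflow X \<phi>}"

(* The cardinality of an infinite set is 0 by convention; since the trivial semiflow
   always exists, num_semiflows X = 0 means that there are infinitely many semiflows. *)
definition num_semiflows :: "'a topology \<Rightarrow> nat" where
  "num_semiflows X = card (semiflows X)"

end

theory Submission
  imports Defs
begin

text \<open>Semiflows on a finite \<open>T\<^sub>0\<close>-space descend in the specialization order, and since they take only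
  finitely many values, the semigroup law forces each of them to jump at time \<open>0\<close> to a fixed
  interior operator, i.e. a continuous idempotent map below the identity, and to stay there.
  For \<open>N \<ge> 1\<close> take the poset with elements \<open>p\<^sub>i\<close> (\<open>1 \<le> i < N\<close>) and \<open>c\<^sub>i\<close>, \<open>a\<^sub>i\<close> (\<open>0 \<le> i < N\<close>), where the
  \<open>p\<^sub>i\<close> and \<open>c\<^sub>0\<close> are minimal, \<open>c\<^sub>i\<close> covers \<open>c\<^bsub>i-1\<^esub>\<close> and \<open>p\<^sub>i\<close>, the point \<open>a\<^sub>0\<close> covers \<open>c\<^sub>0\<close>, and \<open>a\<^sub>i\<close> covers
  \<open>a\<^bsub>i-1\<^esub>\<close> and \<open>c\<^sub>i\<close>. Its only down beat point is \<open>a\<^sub>0\<close>, and an interior operator fixes all \<open>p\<^sub>i\<close> and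
  \<open>c\<^sub>i\<close> and sends exactly the \<open>a\<^sub>i\<close> with \<open>i < k\<close> to \<open>c\<^sub>i\<close>, for some \<open>k \<le> N\<close>. This gives \<open>N + 1\<close> semiflows.\<close>

section \<open>The specialization order\<close>

lemma self_mem_min_open: "x \<in> min_open X x"
  by (auto simp: min_open_def)

lemma min_open_subset_openin: "openin X U \<Longrightarrow> x \<in> U \<Longrightarrow> min_open X x \<subseteq> U"
  by (auto simp: min_open_def)

lemma openin_min_open:
  assumes "finite (topspace X)" "x \<in> topspace X"
  shows "openin X (min_open X x)"
  unfolding min_open_def
proof (rule openin_Inter)
  have "{U. openin X U \<and> x \<in> U} \<subseteq> Pow (topspace X)"
    using openin_subset by blast
  then show "finite {U. openin X U \<and> x \<in> U}"
    using assms(1) by (meson finite_Pow_iff finite_subset)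
  show "{U. openin X U \<and> x \<in> U} \<noteq> {}"
    using assms(2) by auto
qed auto

lemma spec_le_refl: "spec_le X x x"
  by (simp add: spec_le_def)

lemma spec_le_trans: "spec_le X x y \<Longrightarrow> spec_le X y z \<Longrightarrow> spec_le X x z"
  by (auto simp: spec_le_def)

lemma openin_spec_le_closed: "openin X U \<Longrightarrow> x \<in> U \<Longrightarrow> spec_le X y x \<Longrightarrow> y \<in> U"
  by (metis min_open_subset_openin self_mem_min_open spec_le_def subsetD)

lemma spec_le_iff_mem_min_open:
  assumes "finite (topspace X)" "x \<in> topspace X"
  shows "spec_le X y x \<longleftrightarrow> y \<in> min_open X x"
  by (metis min_open_subset_openin openin_min_open[OF assms] self_mem_min_open spec_le_def subsetD)

lemma spec_le_antisym:
  assumes "t0_space X" "x \<in> topspace X" "y \<in> topspace X" "spec_le X x y" "spec_le X y x"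
  shows "x = y"
  using assms openin_spec_le_closed unfolding t0_space_def by metis

text \<open>The preimage of \<open>min_open Y (f y)\<close> is an open set containing
  \<open>y\<close>, and open sets are closed downwards.\<close>

lemma continuous_map_spec_le_mono:
  assumes fin: "finite (topspace Y)" and f: "continuous_map X Y f"
    and y: "y \<in> topspace X" and le: "spec_le X x y"
  shows "spec_le Y (f x) (f y)"
proof -
  have fy: "f y \<in> topspace Y"
    using f y by (auto simp: continuous_map_def)
  have "openin X {z \<in> topspace X. f z \<in> min_open Y (f y)}"
    using openin_continuous_map_preimage[OF f] openin_min_open[OF fin fy] by blast
  from openin_spec_le_closed[OF this _ le] show ?thesis
    using y by (simp add: self_mem_min_open spec_le_iff_mem_min_open[OF fin fy])
qed

section \<open>Semiflows and interior operators\<close>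

definition interior_operators :: "'a topology \<Rightarrow> ('a \<Rightarrow> 'a) set" where
  "interior_operators X = {f \<in> extensional (topspace X). continuous_map X X f \<and>
     (\<forall>x \<in> topspace X. spec_le X (f x) x \<and> f (f x) = f x)}"

lemma semiflow_continuous_map:
  assumes "semiflow X \<phi>" "0 \<le> t"
  shows "continuous_map X X (\<lambda>x. \<phi> (t, x))"
proof -
  have "continuous_map X (prod_topology (top_of_set {0..}) X) (\<lambda>x. (t, x))"
    using assms(2) by (auto intro!: continuous_map_pairedI)
  from continuous_map_compose[OF this] assms(1) show ?thesis
    by (auto simp: semiflow_def o_def)
qed

lemma semiflow_in_topspace:
  assumes "semiflow X \<phi>" "0 \<le> t" "x \<in> topspace X"
  shows "\<phi> (t, x) \<in> topspace X"
  using semiflow_continuous_map[OF assms(1,2)] assms(3) by (auto simp: continuous_map_def)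

lemma semiflow_add:
  assumes "semiflow X \<phi>" "0 \<le> s" "0 \<le> t" "x \<in> topspace X"
  shows "\<phi> (s + t, x) = \<phi> (s, \<phi> (t, x))"
  using assms by (auto simp: semiflow_def)

text \<open>The orbit of \<open>x\<close> is continuous in time, so the times at which it lies in
  the minimal open set of \<open>x\<close> form a neighbourhood of 0.\<close>

lemma semiflow_spec_le_near_0:
  assumes fin: "finite (topspace X)" and \<phi>: "semiflow X \<phi>" and x: "x \<in> topspace X"
  shows "\<forall>\<^sub>F t in at_right 0. spec_le X (\<phi> (t, x)) x"
proof -
  have "continuous_map (top_of_set {0..}) (prod_topology (top_of_set {0..}) X) (\<lambda>t::real. (t, x))"
    using x by (auto intro!: continuous_map_pairedI)
  from continuous_map_compose[OF this] \<phi>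
  have c: "continuous_map (top_of_set {0..}) X (\<lambda>t. \<phi> (t, x))"
    by (auto simp: semiflow_def o_def)
  define T where "T = {t \<in> {0..}. \<phi> (t, x) \<in> min_open X x}"
  have "openin (top_of_set {0..}) T"
    using openin_continuous_map_preimage[OF c openin_min_open[OF fin x]] by (simp add: T_def)
  moreover have "0 \<in> T"
    using \<phi> x by (simp add: T_def semiflow_def self_mem_min_open)
  ultimately obtain d where "d > 0" and d: "\<And>t. t \<in> {0..} \<Longrightarrow> dist t 0 < d \<Longrightarrow> t \<in> T"
    unfolding openin_euclidean_subtopology_iff by blast
  have "spec_le X (\<phi> (t, x)) x" if "0 < t" "t < d" for t
    using d[of t] that by (auto simp: T_def spec_le_iff_mem_min_open[OF fin x])
  then show ?thesis
    using \<open>d > 0\<close> unfolding eventually_at_right_field by blast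
qed

text \<open>Finiteness of the space yields one \<open>d\<close> that serves all points. Any time
  \<open>t\<close> splits into \<open>k\<close> equal steps shorter than \<open>d\<close>, and each
  step descends.\<close>

lemma semiflow_spec_le:
  assumes fin: "finite (topspace X)" and \<phi>: "semiflow X \<phi>"
    and x: "x \<in> topspace X" and t: "0 \<le> t"
  shows "spec_le X (\<phi> (t, x)) x"
proof -
  have "\<forall>\<^sub>F t in at_right 0. \<forall>x\<in>topspace X. spec_le X (\<phi> (t, x)) x"
    using semiflow_spec_le_near_0[OF fin \<phi>] fin by (simp add: eventually_ball_finite)
  then obtain d where "d > 0"
    and d: "\<And>s x. 0 < s \<Longrightarrow> s < d \<Longrightarrow> x \<in> topspace X \<Longrightarrow> spec_le X (\<phi> (s, x)) x"
    unfolding eventually_at_right_field by blast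
  have step: "spec_le X (\<phi> (s, y)) y" if "0 \<le> s" "s < d" "y \<in> topspace X" for s y
  proof (cases "s = 0")
    case True
    then show ?thesis using \<phi> that by (auto simp: semiflow_def spec_le_refl)
  next
    case False
    then show ?thesis using d that by auto
  qed
  have multiple: "spec_le X (\<phi> (real k * s, x)) x" if s: "0 \<le> s" "s < d" for k s
  proof (induction k)
    case 0
    then show ?case using step[of 0] x \<open>d > 0\<close> by simp
  next
    case (Suc k)
    have "\<phi> (real (Suc k) * s, x) = \<phi> (s, \<phi> (real k * s, x))"
      using semiflow_add[OF \<phi> s(1) _ x, of "real k * s"] s(1) by (simp add: algebra_simps)
    moreover have "spec_le X (\<phi> (s, \<phi> (real k * s, x))) (\<phi> (real k * s, x))"
      using step s semiflow_in_topspace[OF \<phi> _ x] by simp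
    ultimately show ?case using Suc spec_le_trans by metis
  qed
  obtain k :: nat where "t / d < real k"
    using reals_Archimedean2 by blast
  moreover from this have "0 < real k"
    using t \<open>d > 0\<close> by (metis divide_nonneg_pos order_le_less_trans)
  ultimately show ?thesis
    using multiple[of "t / real k" k] t \<open>d > 0\<close> by (simp add: field_simps)
qed

lemma semiflow_antimono:
  assumes fin: "finite (topspace X)" and \<phi>: "semiflow X \<phi>"
    and x: "x \<in> topspace X" and st: "0 \<le> s" "s \<le> t"
  shows "spec_le X (\<phi> (t, x)) (\<phi> (s, x))"
proof -
  have "\<phi> (t, x) = \<phi> (t - s, \<phi> (s, x))"
    using semiflow_add[OF \<phi> _ st(1) x, of "t - s"] st by simp
  then show ?thesis
    using semiflow_spec_le[OF fin \<phi> semiflow_in_topspace[OF \<phi> st(1) x]] st by simp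
qed

text \<open>A point that returns at time \<open>s\<close> returns at every multiple of
  \<open>s\<close>. Its position at time \<open>t\<close> is squeezed between a later return and the
  start.\<close>

lemma semiflow_fixed:
  assumes fin: "finite (topspace X)" and t0: "t0_space X" and \<phi>: "semiflow X \<phi>"
    and y: "y \<in> topspace X" and s: "0 < s" "\<phi> (s, y) = y" and t: "0 \<le> t"
  shows "\<phi> (t, y) = y"
proof -
  have multiple: "\<phi> (real k * s, y) = y" for k
  proof (induction k)
    case 0
    then show ?case using \<phi> y by (simp add: semiflow_def)
  next
    case (Suc k)
    then show ?case
      using semiflow_add[OF \<phi> _ _ y, of s "real k * s"] s by (simp add: algebra_simps)
  qed
  obtain k :: nat where "t / s < real k"
    using reals_Archimedean2 by blast
  then have "t \<le> real k * s"
    using s by (simp add: field_simps)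
  then have "spec_le X y (\<phi> (t, y))"
    using semiflow_antimono[OF fin \<phi> y t] multiple by metis
  then show ?thesis
    using semiflow_spec_le[OF fin \<phi> y t] semiflow_in_topspace[OF \<phi> t y] y
    by (meson spec_le_antisym[OF t0])
qed

lemma semiflow_constant:
  assumes fin: "finite (topspace X)" and t0: "t0_space X" and \<phi>: "semiflow X \<phi>"
    and x: "x \<in> topspace X"
  obtains y where "\<And>t. 0 < t \<Longrightarrow> \<phi> (t, x) = y"
proof -
  \<comment> \<open>\<open>g\<close> is a rank that drops whenever the descending orbit moves. Its
    largest value over positive times is attained at some \<open>s\<close>, so the orbit cannot move
    on (0, s].\<close>
  define g where "g t = card (min_open X (\<phi> (t, x)))" for t
  have sub: "min_open X (\<phi> (t, x)) \<subseteq> topspace X" if "0 \<le> t" for t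
    using openin_min_open[OF fin semiflow_in_topspace[OF \<phi> that x]] by (rule openin_subset)
  have "g ` {0<..} \<subseteq> {..card (topspace X)}"
    using sub card_mono[OF fin] by (auto simp: g_def)
  then have "finite (g ` {0<..})"
    using finite_subset by blast
  then have "Max (g ` {0<..}) \<in> g ` {0<..}"
    by (rule Max_in) auto
  then obtain s where s: "0 < s" and "g s = Max (g ` {0<..})"
    by auto
  with \<open>finite (g ` {0<..})\<close> have max: "g t \<le> g s" if "0 < t" for t
    using that by simp
  have eq: "\<phi> (t, x) = \<phi> (s, x)" if t: "0 < t" "t \<le> s" for t
  proof -
    have le: "spec_le X (\<phi> (s, x)) (\<phi> (t, x))"
      using semiflow_antimono[OF fin \<phi> x] t by simp
    have "min_open X (\<phi> (s, x)) = min_open X (\<phi> (t, x))"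
    proof (rule card_seteq)
      show "finite (min_open X (\<phi> (t, x)))"
        using sub[of t] t fin finite_subset by auto
      show "min_open X (\<phi> (s, x)) \<subseteq> min_open X (\<phi> (t, x))"
        using le by (simp add: spec_le_def)
      show "card (min_open X (\<phi> (t, x))) \<le> card (min_open X (\<phi> (s, x)))"
        using max[OF t(1)] by (simp add: g_def)
    qed
    then have "spec_le X (\<phi> (t, x)) (\<phi> (s, x))"
      by (simp add: spec_le_def)
    with le show ?thesis
      using spec_le_antisym[OF t0] semiflow_in_topspace[OF \<phi> _ x] t s by simp
  qed
  define y where "y = \<phi> (s, x)"
  have y: "y \<in> topspace X"
    using semiflow_in_topspace[OF \<phi> _ x] s by (simp add: y_def)
  \<comment> \<open>The orbit of \<open>x\<close> is at \<open>y\<close> both at time s/2 and at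
    time s, so flowing for s/2 from \<open>y\<close> leads back to \<open>y\<close>.\<close>
  have "\<phi> (s/2, y) = y"
    using semiflow_add[OF \<phi> _ _ x, of "s/2" "s/2"] eq[of "s/2"] s by (simp add: y_def)
  then have fixed: "\<phi> (t, y) = y" if "0 \<le> t" for t
    using semiflow_fixed[OF fin t0 \<phi> y, of "s/2"] that s by simp
  have "\<phi> (t, x) = y" if "0 < t" for t
  proof (cases "t \<le> s")
    case True
    then show ?thesis using eq[OF that] by (simp add: y_def)
  next
    case False
    then show ?thesis
      using semiflow_add[OF \<phi> _ _ x, of "t - s" s] fixed[of "t - s"] s by (simp add: y_def)
  qed
  then show thesis by (rule that)
qed

section \<open>The correspondence between semiflows and interior operators\<close>

lemma semiflow_jump:
  assumes f: "f \<in> interior_operators X"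
  shows "semiflow X (restrict (\<lambda>(t, x). if t = 0 then x else f x) ({0..} \<times> topspace X))"
    (is "semiflow X ?\<phi>")
proof -
  have cont: "continuous_map X X f"
    and le: "\<And>x. x \<in> topspace X \<Longrightarrow> spec_le X (f x) x"
    and idem: "\<And>x. x \<in> topspace X \<Longrightarrow> f (f x) = f x"
    using f by (auto simp: interior_operators_def)
  have mem: "f x \<in> topspace X" if "x \<in> topspace X" for x
    using cont that by (auto simp: continuous_map_def)
  have "openin (prod_topology (top_of_set {0..}) X)
      {p \<in> topspace (prod_topology (top_of_set {0..}) X). ?\<phi> p \<in> U}" if U: "openin X U" for U
  proof -
    \<comment> \<open>Since \<open>f\<close> lies below the identity and \<open>U\<close> is a lower
      set, \<open>f\<close> maps \<open>U\<close> into itself. So points of \<open>U\<close> belong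
      at every time, and time 0 needs no separate slice.\<close>
    have "{p \<in> topspace (prod_topology (top_of_set {0..}) X). ?\<phi> p \<in> U} =
        {0..} \<times> U \<union> {0<..} \<times> {x \<in> topspace X. f x \<in> U}"
      using openin_subset[OF U] openin_spec_le_closed[OF U _ le] by (auto split: if_splits)
    moreover have "openin (top_of_set {0..}) {0::real<..}"
      by (rule open_subset) auto
    moreover have "openin (top_of_set {0..}) {0::real..}"
      by simp
    ultimately show ?thesis
      using U openin_continuous_map_preimage[OF cont U]
      by (auto intro!: openin_Un simp: openin_prod_Times_iff)
  qed
  then have "continuous_map (prod_topology (top_of_set {0..}) X) X ?\<phi>"
    by (auto simp: continuous_map_def mem)
  then show ?thesis
    by (auto simp: semiflow_def mem idem)
qed

text \<open>All positive times of a semiflow give the same map, so evaluation at time 1 inverts the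
  jump construction.\<close>

theorem num_semiflows_eq_card_interior_operators:
  assumes fin: "finite (topspace X)" and t0: "t0_space X"
  shows "num_semiflows X = card (interior_operators X)"
proof -
  let ?S = "{0::real..} \<times> topspace X"
  let ?F = "\<lambda>f. restrict (\<lambda>(t, x). if t = 0 then x else f x) ?S"
  let ?G = "\<lambda>\<phi>. restrict (\<lambda>x. \<phi> (1::real, x)) (topspace X)"
  have const: "\<phi> (t, x) = \<phi> (1, x)" if "semiflow X \<phi>" "0 < t" "x \<in> topspace X" for \<phi> t x
    using semiflow_constant[OF fin t0 that(1,3)] that(2) by (metis zero_less_one)
  have "bij_betw ?F (interior_operators X) (semiflows X)"
  proof (rule bij_betw_byWitness[where f' = ?G])
    show "\<forall>f\<in>interior_operators X. ?G (?F f) = f"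
      by (auto simp: interior_operators_def fun_eq_iff extensional_def)
    show "\<forall>\<phi>\<in>semiflows X. ?F (?G \<phi>) = \<phi>"
    proof (intro ballI ext)
      fix \<phi> and p :: "real \<times> 'a" assume "\<phi> \<in> semiflows X"
      then have ext: "\<phi> \<in> extensional ?S" and \<phi>: "semiflow X \<phi>"
        by (auto simp: semiflows_def)
      obtain t x where p: "p = (t, x)" by fastforce
      consider "p \<notin> ?S" | "t = 0" "x \<in> topspace X" | "0 < t" "x \<in> topspace X"
        using p by fastforce
      then show "?F (?G \<phi>) p = \<phi> p"
      proof cases
        case 1
        then show ?thesis using extensional_arb[OF ext 1] by simp
      next
        case 2
        then show ?thesis using p \<phi> by (simp add: semiflow_def)
      next
        case 3
        then show ?thesis using p const[OF \<phi> 3] by simp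
      qed
    qed
    show "?F ` interior_operators X \<subseteq> semiflows X"
      by (auto simp: semiflows_def semiflow_jump)
    show "?G ` semiflows X \<subseteq> interior_operators X"
    proof
      fix f assume "f \<in> ?G ` semiflows X"
      then obtain \<phi> where \<phi>: "semiflow X \<phi>" and f: "f = ?G \<phi>"
        by (auto simp: semiflows_def)
      have "continuous_map X X f"
        using semiflow_continuous_map[OF \<phi>, of 1] by (auto simp: f intro: continuous_map_eq)
      moreover have "spec_le X (f x) x" if "x \<in> topspace X" for x
        using semiflow_spec_le[OF fin \<phi> that] that by (simp add: f)
      \<comment> \<open>Applying \<open>f\<close> twice is flowing up to time 2, which agrees with
        time 1.\<close>
      moreover have "f (f x) = f x" if "x \<in> topspace X" for x
        using semiflow_add[OF \<phi> _ _ that, of 1 1] const[OF \<phi> _ that, of 2] that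
          semiflow_in_topspace[OF \<phi> _ that] by (simp add: f)
      ultimately show "f \<in> interior_operators X"
        by (auto simp: interior_operators_def f)
    qed
  qed
  then show ?thesis
    by (simp add: num_semiflows_def bij_betw_same_card)
qed

section \<open>Spaces of lower sets\<close>

definition lower_topology :: "'a set \<Rightarrow> ('a \<Rightarrow> 'a \<Rightarrow> bool) \<Rightarrow> 'a topology" where
  "lower_topology A le = topology (\<lambda>U. U \<subseteq> A \<and> (\<forall>x\<in>U. \<forall>y\<in>A. le y x \<longrightarrow> y \<in> U))"

lemma openin_lower_topology:
  "openin (lower_topology A le) U \<longleftrightarrow> U \<subseteq> A \<and> (\<forall>x\<in>U. \<forall>y\<in>A. le y x \<longrightarrow> y \<in> U)"
proof -
  have "istopology (\<lambda>U. U \<subseteq> A \<and> (\<forall>x\<in>U. \<forall>y\<in>A. le y x \<longrightarrow> y \<in> U))"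
    unfolding istopology_def by blast
  then show ?thesis
    by (simp add: lower_topology_def topology_inverse')
qed

lemma topspace_lower_topology [simp]: "topspace (lower_topology A le) = A"
  unfolding topspace_def openin_lower_topology by blast

lemma min_open_lower_topology:
  assumes "x \<in> A" "reflp_on A le" "transp_on A le"
  shows "min_open (lower_topology A le) x = {y \<in> A. le y x}"
proof
  have "openin (lower_topology A le) {y \<in> A. le y x}"
    using assms(1) transp_onD[OF assms(3)] unfolding openin_lower_topology by blast
  moreover have "x \<in> {y \<in> A. le y x}"
    using assms(1,2) by (simp add: reflp_onD)
  ultimately show "min_open (lower_topology A le) x \<subseteq> {y \<in> A. le y x}"
    by (rule min_open_subset_openin)
  show "{y \<in> A. le y x} \<subseteq> min_open (lower_topology A le) x"
    using assms(1) by (auto simp: min_open_def openin_lower_topology)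
qed

lemma spec_le_lower_topology:
  assumes "x \<in> A" "y \<in> A" "reflp_on A le" "transp_on A le"
  shows "spec_le (lower_topology A le) x y \<longleftrightarrow> le x y"
  unfolding spec_le_def min_open_lower_topology[OF assms(1,3,4)] min_open_lower_topology[OF assms(2,3,4)]
  using assms(1,2) reflp_onD[OF assms(3)] transp_onD[OF assms(4)] by blast

lemma t0_space_lower_topology:
  assumes "reflp_on A le" "transp_on A le" "antisymp_on A le"
  shows "t0_space (lower_topology A le)"
proof (unfold t0_space_def topspace_lower_topology, intro ballI impI)
  fix x y assume xy: "x \<in> A" "y \<in> A" "x \<noteq> y"
  have open_down: "openin (lower_topology A le) {z \<in> A. le z w}" if "w \<in> A" for w
    using that transp_onD[OF assms(2)] unfolding openin_lower_topology by blast
  have "\<not> (le x y \<and> le y x)"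
    using xy assms(3) antisymp_onD by metis
  then show "\<exists>U. openin (lower_topology A le) U \<and> (x \<notin> U) = (y \<in> U)"
    using open_down[of x] open_down[of y] xy reflp_onD[OF assms(1)] by blast
qed

lemma continuous_map_lower_topology:
  assumes "\<And>x. x \<in> A \<Longrightarrow> f x \<in> A"
    and "\<And>x y. x \<in> A \<Longrightarrow> y \<in> A \<Longrightarrow> le x y \<Longrightarrow> le (f x) (f y)"
  shows "continuous_map (lower_topology A le) (lower_topology A le) f"
  using assms by (auto simp: continuous_map_def openin_lower_topology)

section \<open>The ladder\<close>

text \<open>In the notation of the introduction, \<open>p\<^sub>i\<close>, \<open>c\<^sub>i\<close> and \<open>a\<^sub>i\<close> are encoded as \<open>3i\<close>, \<open>3i + 1\<close> and \<open>3i + 2\<close>;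
  starting the carrier at \<open>1\<close> omits \<open>p\<^sub>0\<close>. Once the residues are ordered, comparing the codes amounts to
  comparing the indices \<open>i\<close>.\<close>

definition ladder_le :: "nat \<Rightarrow> nat \<Rightarrow> bool" where
  "ladder_le x y \<longleftrightarrow> x = y \<or> x \<le> y \<and> x mod 3 \<le> y mod 3 \<and> y mod 3 \<noteq> 0"

definition ladder :: "nat \<Rightarrow> nat topology" where
  "ladder N = lower_topology {1..<3 * N} ladder_le"

text \<open>Subtracting 1 turns the code of a_i into that of c_i. The extremes are the identity for
  \<open>k = 0\<close> and the collapse of all a_i for \<open>k = N\<close>.\<close>

definition ladder_retraction :: "nat \<Rightarrow> nat \<Rightarrow> nat \<Rightarrow> nat" where
  "ladder_retraction N k =
     restrict (\<lambda>x. if x mod 3 = 2 \<and> x div 3 < k then x - 1 else x) {1..<3 * N}"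

lemma ladder_le_order:
  "reflp_on A ladder_le" "transp_on A ladder_le" "antisymp_on A ladder_le"
proof -
  show "reflp_on A ladder_le"
    by (auto intro!: reflp_onI simp: ladder_le_def)
  show "transp_on A ladder_le"
    by (rule transp_onI) (auto simp: ladder_le_def)
  show "antisymp_on A ladder_le"
    by (rule antisymp_onI) (auto simp: ladder_le_def)
qed

lemma topspace_ladder [simp]: "topspace (ladder N) = {1..<3 * N}"
  by (simp add: ladder_def)

lemma t0_space_ladder: "t0_space (ladder N)"
  by (simp add: ladder_def t0_space_lower_topology ladder_le_order)

lemma spec_le_ladder:
  "x \<in> {1..<3 * N} \<Longrightarrow> y \<in> {1..<3 * N} \<Longrightarrow> spec_le (ladder N) x y \<longleftrightarrow> ladder_le x y"
  by (simp add: ladder_def spec_le_lower_topology ladder_le_order)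

lemma min_open_ladder:
  "x \<in> {1..<3 * N} \<Longrightarrow> min_open (ladder N) x = {y \<in> {1..<3 * N}. ladder_le y x}"
  by (simp add: ladder_def min_open_lower_topology ladder_le_order)

text \<open>The cases are the codes of p_i, c_i and a_i, in this order.\<close>

lemma mod_3_cases:
  fixes x :: nat
  obtains i where "x = 3 * i" | i where "x = 3 * i + 1" | i where "x = 3 * i + 2"
proof -
  have "x = 3 * (x div 3) + x mod 3" "x mod 3 < 3"
    by simp_all
  then consider "x = 3 * (x div 3)" | "x = 3 * (x div 3) + 1" | "x = 3 * (x div 3) + 2"
    by linarith
  then show thesis
    using that by cases blast+
qed

lemma mod_3_simps [simp]:
  fixes i :: nat
  shows "(3 * i + 1) mod 3 = 1" "(3 * i + 2) mod 3 = 2"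
    "Suc (3 * i) mod 3 = 1" "Suc (Suc (3 * i)) mod 3 = 2"
  by (simp_all add: mod_Suc)

lemma ladder_le_0_iff: "ladder_le x (3 * i) \<longleftrightarrow> x = 3 * i"
  by (simp add: ladder_le_def)

lemma ladder_le_imp_le: "ladder_le x y \<Longrightarrow> x \<le> y"
  by (auto simp: ladder_le_def)

text \<open>The codes leave only p_{i+1} and c_{i+1} for \<open>y\<close>, and the minimal p_{i+1}
  is not above c_i. This both excludes c_{i+1} as a down beat point and forces interior operators to
  fix it.\<close>

lemma ladder_between_1:
  assumes "ladder_le (3 * i + 1) y" "ladder_le (3 * Suc i) y" "ladder_le y (3 * Suc i + 1)"
  shows "y = 3 * Suc i + 1"
proof -
  have "y = 3 * Suc i \<or> y = 3 * Suc i + 1"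
    using assms[THEN ladder_le_imp_le] by linarith
  moreover have "y \<noteq> 3 * Suc i"
    using assms(1) ladder_le_0_iff[of _ "Suc i"] by auto
  ultimately show ?thesis by blast
qed

text \<open>The analogue for a_{i+1}, which excludes it as a down beat point: the other candidate
  c_{i+1} is not above a_i.\<close>

lemma ladder_between_2:
  assumes "ladder_le (3 * i + 2) y" "ladder_le (3 * Suc i + 1) y" "ladder_le y (3 * Suc i + 2)"
  shows "y = 3 * Suc i + 2"
proof -
  have "y = 3 * Suc i + 1 \<or> y = 3 * Suc i + 2"
    using assms[THEN ladder_le_imp_le] by linarith
  moreover have "\<not> ladder_le (3 * i + 2) (3 * Suc i + 1)"
    unfolding ladder_le_def mod_3_simps by simp
  ultimately show ?thesis using assms(1) by blast
qed

section \<open>The down beat points of the ladder\<close>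

lemma down_beat_points_ladder:
  assumes "N \<ge> 1"
  shows "down_beat_points (ladder N) = {2}"
proof -
  have beat: "x \<in> down_beat_points (ladder N) \<longleftrightarrow> x \<in> {1..<3 * N} \<and>
      (\<exists>m\<in>{1..<3 * N}. m \<noteq> x \<and> ladder_le m x \<and>
        (\<forall>y\<in>{1..<3 * N}. y \<noteq> x \<and> ladder_le y x \<longrightarrow> ladder_le y m))" (is "_ \<longleftrightarrow> ?beat x") for x
  proof (cases "x \<in> {1..<3 * N}")
    case True
    let ?L = "{y \<in> {1..<3 * N}. y \<noteq> x \<and> ladder_le y x}"
    have "min_open (ladder N) x - {x} = ?L"
      unfolding min_open_ladder[OF True] by blast
    then have "x \<in> down_beat_points (ladder N) \<longleftrightarrow> (\<exists>m\<in>?L. \<forall>y\<in>?L. spec_le (ladder N) y m)"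
      using True by (simp add: down_beat_points_def)
    also have "\<dots> \<longleftrightarrow> (\<exists>m\<in>?L. \<forall>y\<in>?L. ladder_le y m)"
      by (intro bex_cong ball_cong refl spec_le_ladder) auto
    finally show ?thesis
      using True by blast
  next
    case False
    then have "x \<notin> down_beat_points (ladder N)"
      unfolding down_beat_points_def topspace_ladder by blast
    with False show ?thesis by blast
  qed
  have "x = 2" if "?beat x" for x
  proof -
    from that obtain m where x: "x \<in> {1..<3 * N}" and m: "m \<in> {1..<3 * N}" "m \<noteq> x" "ladder_le m x"
      and max: "\<And>y. y \<in> {1..<3 * N} \<Longrightarrow> y \<noteq> x \<Longrightarrow> ladder_le y x \<Longrightarrow> ladder_le y m"
      by blast
    show ?thesis
    proof (cases x rule: mod_3_cases)
      case (1 i)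
      then show ?thesis using m by (simp add: ladder_le_def)
    next
      case (2 i)
      show ?thesis
      proof (cases i)
        case 0
        then show ?thesis using 2 m ladder_le_imp_le[OF m(3)] by simp
      next
        case (Suc j)
        \<comment> \<open>A maximum \<open>m\<close> strictly below c_i would bound both of its
          lower covers, and then \<open>m\<close> would be c_i itself. The a_i with positive index
          are excluded in the same way.\<close>
        have "ladder_le (3 * j + 1) m" "ladder_le (3 * Suc j) m"
          using max[of "3 * j + 1"] max[of "3 * Suc j"] 2 Suc x by (auto simp: ladder_le_def)
        then show ?thesis using ladder_between_1 2 Suc m by blast
      qed
    next
      case (3 i)
      show ?thesis
      proof (cases i)
        case (Suc j)
        have "ladder_le (3 * j + 2) m" "ladder_le (3 * Suc j + 1) m"
          using max[of "3 * j + 2"] max[of "3 * Suc j + 1"] 3 Suc x by (auto simp: ladder_le_def)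
        then show ?thesis using ladder_between_2 3 Suc m by blast
      qed (use 3 in simp)
    qed
  qed
  moreover have "?beat 2"
  proof (intro conjI bexI[of _ 1] ballI impI)
    fix y :: nat assume "y \<in> {1..<3 * N}" "y \<noteq> 2 \<and> ladder_le y 2"
    then have "y = 1" using ladder_le_imp_le[of y 2] by auto
    then show "ladder_le y 1" by (simp add: ladder_le_def)
  qed (use assms in \<open>auto simp: ladder_le_def\<close>)
  ultimately show ?thesis
    using beat by blast
qed

section \<open>The interior operators of the ladder\<close>

lemma ladder_retraction_mem:
  "x \<in> {1..<3 * N} \<Longrightarrow> ladder_retraction N k x \<in> {1..<3 * N}"
  by (auto simp: ladder_retraction_def)

lemma ladder_retraction_interior:
  "ladder_retraction N k \<in> interior_operators (ladder N)"
proof -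
  let ?f = "ladder_retraction N k"
  \<comment> \<open>The threshold matters when a_i is below a_j: if a_j is lowered, then i \<le> j <
    k, so a_i is lowered too.\<close>
  have "ladder_le (?f x) (?f y)" if "x \<in> {1..<3 * N}" "y \<in> {1..<3 * N}" "ladder_le x y" for x y
    using that by (cases x rule: mod_3_cases; cases y rule: mod_3_cases)
      (auto simp: ladder_retraction_def ladder_le_def, presburger+)
  then have "continuous_map (ladder N) (ladder N) ?f"
    unfolding ladder_def using ladder_retraction_mem by (intro continuous_map_lower_topology)
  moreover have "ladder_le (?f x) x" "?f (?f x) = ?f x" if "x \<in> {1..<3 * N}" for x
    using that by (cases x rule: mod_3_cases; auto simp: ladder_retraction_def ladder_le_def)+
  ultimately show ?thesis
    using ladder_retraction_mem
    by (auto simp: interior_operators_def spec_le_ladder) (simp add: ladder_retraction_def)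
qed

lemma interior_operator_ladder:
  assumes f: "f \<in> interior_operators (ladder N)"
  obtains k where "k \<le> N" "f = ladder_retraction N k"
proof -
  let ?A = "{1..<3 * N}"
  have ext: "f \<in> extensional ?A" and cont: "continuous_map (ladder N) (ladder N) f"
    using f by (auto simp: interior_operators_def)
  have mem: "f x \<in> ?A" if "x \<in> ?A" for x
    using cont that by (auto simp: continuous_map_def)
  have le: "ladder_le (f x) x" if "x \<in> ?A" for x
    using f that mem spec_le_ladder[of "f x" N x] by (auto simp: interior_operators_def)
  have mono: "ladder_le (f x) (f y)" if "x \<in> ?A" "y \<in> ?A" "ladder_le x y" for x y
  proof -
    have "spec_le (ladder N) (f x) (f y)"
      using continuous_map_spec_le_mono[OF _ cont] that by (simp add: spec_le_ladder)
    then show ?thesis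
      using spec_le_ladder[OF mem mem] that by simp
  qed
  have f0: "f (3 * i) = 3 * i" if "3 * i \<in> ?A" for i
    using le[OF that] by (simp add: ladder_le_def)
  \<comment> \<open>Induction up the chain of the c_i: the image of c_{i+1} lies above the fixed
    points c_i and p_{i+1}.\<close>
  have f1: "f (3 * i + 1) = 3 * i + 1" if "i < N" for i
    using that
  proof (induction i)
    case 0
    then have "f 1 \<in> ?A" "ladder_le (f 1) 1"
      using mem[of 1] le[of 1] by auto
    then have "f 1 = 1"
      using ladder_le_imp_le by fastforce
    then show ?case by simp
  next
    case (Suc i)
    define y where "y = f (3 * Suc i + 1)"
    have "ladder_le (3 * i + 1) y" "ladder_le (3 * Suc i) y"
      using mono[of "3 * i + 1" "3 * Suc i + 1"] mono[of "3 * Suc i" "3 * Suc i + 1"] Suc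
        f0[of "Suc i"] by (auto simp: y_def ladder_le_def)
    moreover have "ladder_le y (3 * Suc i + 1)"
      using le[of "3 * Suc i + 1"] Suc.prems by (simp add: y_def)
    ultimately have "y = 3 * Suc i + 1"
      by (rule ladder_between_1)
    then show ?case by (simp add: y_def)
  qed
  have f2: "f (3 * i + 2) = 3 * i + 1 \<or> f (3 * i + 2) = 3 * i + 2" if "i < N" for i
  proof -
    have "ladder_le (3 * i + 1) (f (3 * i + 2))"
      using mono[of "3 * i + 1" "3 * i + 2"] f1[OF that] that by (auto simp: ladder_le_def)
    moreover have "ladder_le (f (3 * i + 2)) (3 * i + 2)"
      using le that by simp
    ultimately show ?thesis
      by (auto dest!: ladder_le_imp_le)
  qed
  \<comment> \<open>The fixed a_i form an upper set: the image of a_j lies above a_i, and c_j does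
    not.\<close>
  have up: "f (3 * j + 2) = 3 * j + 2" if "f (3 * i + 2) = 3 * i + 2" "i \<le> j" "j < N" for i j
  proof -
    have "ladder_le (3 * i + 2) (f (3 * j + 2))"
      using mono[of "3 * i + 2" "3 * j + 2"] that by (auto simp: ladder_le_def)
    then show ?thesis
      using f2[OF that(3)] by (auto simp: ladder_le_def) presburger
  qed
  \<comment> \<open>The first index whose a_i is fixed; the disjunct \<open>i = N\<close> covers the
    case that every a_i is lowered.\<close>
  define k where "k = (LEAST i. i = N \<or> f (3 * i + 2) = 3 * i + 2)"
  have k: "k = N \<or> f (3 * k + 2) = 3 * k + 2"
    unfolding k_def by (rule LeastI[of _ N]) simp
  have "k \<le> N"
    unfolding k_def by (rule Least_le) simp
  have below: "f (3 * i + 2) = 3 * i + 1" if "i < k" for i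
    using not_less_Least[OF that[unfolded k_def]] f2[of i] that \<open>k \<le> N\<close> by auto
  have "f = ladder_retraction N k"
  proof
    fix x
    show "f x = ladder_retraction N k x"
    proof (cases "x \<in> ?A")
      case False
      then show ?thesis
        unfolding ladder_retraction_def extensional_arb[OF ext False] restrict_apply
        by (simp only: False if_False)
    next
      case x: True
      show ?thesis
      proof (cases x rule: mod_3_cases)
        case (1 i)
        then show ?thesis using x f0 by (simp add: ladder_retraction_def)
      next
        case (2 i)
        then show ?thesis using x f1 by (simp add: ladder_retraction_def)
      next
        case (3 i)
        then have "i < N" using x by simp
        then show ?thesis
          using x 3 below[of i] up[of k i] k by (cases "i < k") (auto simp: ladder_retraction_def)
      qed
    qed
  qed
  with \<open>k \<le> N\<close> show thesis by (rule that)
qed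

lemma card_interior_operators_ladder: "card (interior_operators (ladder N)) = N + 1"
proof -
  have "interior_operators (ladder N) = ladder_retraction N ` {..N}"
    using ladder_retraction_interior interior_operator_ladder by blast
  moreover have "inj_on (ladder_retraction N) {..N}"
  proof (rule linorder_inj_onI')
    fix k l assume "k \<in> {..N}" "l \<in> {..N}" "k < l"
    \<comment> \<open>The two maps differ at a_k, which only the one with the larger threshold
      lowers.\<close>
    then have "ladder_retraction N k (3 * k + 2) \<noteq> ladder_retraction N l (3 * k + 2)"
      by (simp add: ladder_retraction_def)
    then show "ladder_retraction N k \<noteq> ladder_retraction N l"
      by metis
  qed
  ultimately show ?thesis
    by (simp add: card_image)
qed

theorem theorem4p3:
  fixes n :: nat
  assumes "n \<ge> 2"
  shows "\<exists>X :: nat topology. finite (topspace X) \<and> t0_space X \<and>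
           card (down_beat_points X) = 1 \<and> num_semiflows X = n"
proof (intro exI[of _ "ladder (n - 1)"] conjI)
  show "finite (topspace (ladder (n - 1)))"
    by simp
  show "t0_space (ladder (n - 1))"
    by (rule t0_space_ladder)
  \<comment> \<open>The bound on \<open>n\<close> makes the ladder nonempty, so that the point 2
    exists.\<close>
  show "card (down_beat_points (ladder (n - 1))) = 1"
    using assms by (simp add: down_beat_points_ladder)
  show "num_semiflows (ladder (n - 1)) = n"
    using assms by (simp add: num_semiflows_eq_card_interior_operators t0_space_ladder
        card_interior_operators_ladder)
qed

end
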